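(* Let $\mathfrak U$ and $\mathfrak V$ be generalized models in the wide sense in the same signature with universes $X$ and $Y$, where $X$ and $Y$ carry topologies, $Y$ is Hausdorff, and topologies are fixed on the sets $X^{X^n},\mathcal P(X^n),Y^{Y^n},\mathcal P(Y^n)$. Let $D\subseteq X$ be dense in $X$ and let $\mathfrak D$ be a generalized submodel of $\mathfrak U$ with universe $D$. Let $h:X\to Y$ be continuous, and suppose that for every $n$: (a) $n$-ary functional symbols are interpreted in $\mathfrak U$ by ultrafilters having limits in $RC_D(X^n,X)$ and in $\mathfrak V$ by ultrafilters having limits in $RC_{h``D}(Y^n,Y)$; (b) one of the following holds: ($\alpha$) $n$-ary predicate symbols are interpreted in $\mathfrak U$ by ultrafilters having limits in $\{R\subseteq X^n: R$ is right open w.r.t. $D\}$ and in $\mathfrak V$ by ultrafilters having limits in $\{S\subseteq Y^n:S$ is right closed w.r.t. $h``D\}$; or ($\beta$) $n$-ary predicate symbols are interpreted in $\mathfrak U$ by ultrafilters having limits in $\{R\subseteq X^n:R$ is regular closed$\}$ and in $\mathfrak V$ by ultrafilters having limits in $\{S\subseteq Y^n: S$ is closed$\}$, in the product topologies on $X^n$ and $Y^n$, and $h$ is a closed map. Then the following are equivalent: (i) $h\restriction D$ is a homomorphism of $\mathfrak D$ into $\mathfrak V$; (ii) $h$ is a homomorphism of $\mathfrak U$ into $\mathfrak V$.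
   Context: A generalized model in the wide sense with universe a set $W$ interprets each $n$-ary functional symbol by an ultrafilter on $W^{W^n}$ and each $n$-ary predicate symbol by an ultrafilter on $\mathcal P(W^n)$; it comes with fixed topologies on these sets. An ultrafilter on a topological space has limit $p$ if it converges to $p$ (every neighbourhood of $p$ belongs to it) and to no other point. If all interpreting ultrafilters have limits, $\lim$ of the model is the ordinary model on $W$ interpreting each symbol by the corresponding limit. A map $h$ between universes is a homomorphism of generalized models in the wide sense iff it is a homomorphism (commutes with operations, preserves relations) of the ordinary limit models; "$\mathfrak D$ is a generalized submodel of $\mathfrak U$ with universe $D$" means $\lim\mathfrak D$ exists and is the submodel of $\lim\mathfrak U$ with universe $D$. For a topological space $Z$ and $A\subseteq Z$, $RC_A(Z^n,Z)$ is the set of maps $g:Z^n\to Z$ right continuous w.r.t. $A$: for each $i$, all $a_1,\dots,a_{i-1}\in A$ and all $z_{i+1},\dots,z_n\in Z$, the map $z\mapsto g(a_1,\dots,a_{i-1},z,z_{i+1},\dots,z_n)$ is continuous. A relation $Q\subseteq Z^n$ is right open (right closed) w.r.t. $A$ if each such section $\{z:(a_1,\dots,a_{i-1},z,z_{i+1},\dots,z_n)\in Q\}$ is open (closed). A set is regular closed if it is the closure of an open set. $h``D$ is the image of $D$. *)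

theory Defs
  imports "HOL-Analysis.Analysis"
begin

(* Symbols are given by sets rather than by whole types, so that there may be none of either
   kind.  Arity 0 is allowed. *)
record ('f, 'p) signature =
  fsyms :: "'f set"
  psyms :: "'p set"
  far :: "'f \<Rightarrow> nat"
  par :: "'p \<Rightarrow> nat"

(* The coordinates 1, ..., n are numbered 0, ..., n - 1; tuples are extensional functions, so
   that tuples n W is the carrier of the library's product topology over {..<n}. *)
definition tuples :: "nat \<Rightarrow> 'a set \<Rightarrow> (nat \<Rightarrow> 'a) set" where
  "tuples n W = (\<Pi>\<^sub>E i\<in>{..<n}. W)"

definition power_top :: "'a topology \<Rightarrow> nat \<Rightarrow> (nat \<Rightarrow> 'a) topology" where
  "power_top Z n = product_topology (\<lambda>i. Z) {..<n}"

definition tmap :: "nat \<Rightarrow> ('a \<Rightarrow> 'b) \<Rightarrow> (nat \<Rightarrow> 'a) \<Rightarrow> nat \<Rightarrow> 'b" where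
  "tmap n h x = (\<lambda>i\<in>{..<n}. h (x i))"

definition operations :: "nat \<Rightarrow> 'a set \<Rightarrow> ((nat \<Rightarrow> 'a) \<Rightarrow> 'a) set" where
  "operations n W = (\<Pi>\<^sub>E x\<in>tuples n W. W)"

definition relations :: "nat \<Rightarrow> 'a set \<Rightarrow> (nat \<Rightarrow> 'a) set set" where
  "relations n W = Pow (tuples n W)"


record ('a, 'f, 'p) model =
  mdom :: "'a set"
  fn :: "'f \<Rightarrow> (nat \<Rightarrow> 'a) \<Rightarrow> 'a"
  rel :: "'p \<Rightarrow> (nat \<Rightarrow> 'a) set"

definition model_hom ::
  "('f, 'p) signature \<Rightarrow> ('a, 'f, 'p) model \<Rightarrow> ('b, 'f, 'p) model \<Rightarrow> ('a \<Rightarrow> 'b) \<Rightarrow> bool" where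
  "model_hom sig M N h \<longleftrightarrow>
     h \<in> mdom M \<rightarrow> mdom N \<and>
     (\<forall>f\<in>fsyms sig. \<forall>x\<in>tuples (far sig f) (mdom M).
        h (fn M f x) = fn N f (tmap (far sig f) h x)) \<and>
     (\<forall>p\<in>psyms sig. \<forall>x\<in>tuples (par sig p) (mdom M).
        x \<in> rel M p \<longrightarrow> tmap (par sig p) h x \<in> rel N p)"

definition submodel ::
  "('f, 'p) signature \<Rightarrow> ('a, 'f, 'p) model \<Rightarrow> ('a, 'f, 'p) model \<Rightarrow> bool" where
  "submodel sig N M \<longleftrightarrow>
     mdom N \<subseteq> mdom M \<and>
     (\<forall>f\<in>fsyms sig.
        (\<forall>x\<in>tuples (far sig f) (mdom N). fn M f x \<in> mdom N) \<and>
        fn N f = restrict (fn M f) (tuples (far sig f) (mdom N))) \<and>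
     (\<forall>p\<in>psyms sig. rel N p = rel M p \<inter> tuples (par sig p) (mdom N))"


(* An ultrafilter on S, as a library filter on the ambient type that contains S. *)
definition ultrafilter_on :: "'a set \<Rightarrow> 'a filter \<Rightarrow> bool" where
  "ultrafilter_on S F \<longleftrightarrow>
     F \<le> principal S \<and> F \<noteq> bot \<and>
     (\<forall>A\<subseteq>S. eventually (\<lambda>x. x \<in> A) F \<or> eventually (\<lambda>x. x \<in> S - A) F)"

definition has_limit :: "'a topology \<Rightarrow> 'a filter \<Rightarrow> 'a \<Rightarrow> bool" where
  "has_limit T F p \<longleftrightarrow>
     limitin T (\<lambda>x. x) p F \<and> (\<forall>q. limitin T (\<lambda>x. x) q F \<longrightarrow> q = p)"

definition the_limit :: "'a topology \<Rightarrow> 'a filter \<Rightarrow> 'a" where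
  "the_limit T F = (THE p. has_limit T F p)"

definition has_limit_in :: "'a topology \<Rightarrow> 'a filter \<Rightarrow> 'a set \<Rightarrow> bool" where
  "has_limit_in T F C \<longleftrightarrow> (\<exists>p\<in>C. has_limit T F p)"

record ('a, 'f, 'p) gen_model =
  universe :: "'a set"
  ftop :: "nat \<Rightarrow> ((nat \<Rightarrow> 'a) \<Rightarrow> 'a) topology"
  ptop :: "nat \<Rightarrow> (nat \<Rightarrow> 'a) set topology"
  fint :: "'f \<Rightarrow> ((nat \<Rightarrow> 'a) \<Rightarrow> 'a) filter"
  pint :: "'p \<Rightarrow> (nat \<Rightarrow> 'a) set filter"

definition generalized_model :: "('f, 'p) signature \<Rightarrow> ('a, 'f, 'p) gen_model \<Rightarrow> bool" where
  "generalized_model sig U \<longleftrightarrow>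
     (\<forall>n. topspace (ftop U n) = operations n (universe U)) \<and>
     (\<forall>n. topspace (ptop U n) = relations n (universe U)) \<and>
     (\<forall>f\<in>fsyms sig. ultrafilter_on (operations (far sig f) (universe U)) (fint U f)) \<and>
     (\<forall>p\<in>psyms sig. ultrafilter_on (relations (par sig p) (universe U)) (pint U p))"

definition lim_exists :: "('f, 'p) signature \<Rightarrow> ('a, 'f, 'p) gen_model \<Rightarrow> bool" where
  "lim_exists sig U \<longleftrightarrow>
     (\<forall>f\<in>fsyms sig. \<exists>g. has_limit (ftop U (far sig f)) (fint U f) g) \<and>
     (\<forall>p\<in>psyms sig. \<exists>R. has_limit (ptop U (par sig p)) (pint U p) R)"

(* Meaningful only if lim_exists sig U, and only at the symbols of sig. *)
definition lim_model ::
  "('f, 'p) signature \<Rightarrow> ('a, 'f, 'p) gen_model \<Rightarrow> ('a, 'f, 'p) model" where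
  "lim_model sig U =
     \<lparr>mdom = universe U,
      fn = (\<lambda>f. the_limit (ftop U (far sig f)) (fint U f)),
      rel = (\<lambda>p. the_limit (ptop U (par sig p)) (pint U p))\<rparr>"

definition gen_hom ::
  "('f, 'p) signature \<Rightarrow> ('a, 'f, 'p) gen_model \<Rightarrow> ('b, 'f, 'p) gen_model \<Rightarrow> ('a \<Rightarrow> 'b) \<Rightarrow> bool" where
  "gen_hom sig U V h \<longleftrightarrow>
     lim_exists sig U \<and> lim_exists sig V \<and>
     model_hom sig (lim_model sig U) (lim_model sig V) h"

definition gen_submodel ::
  "('f, 'p) signature \<Rightarrow> ('a, 'f, 'p) gen_model \<Rightarrow> ('a, 'f, 'p) gen_model \<Rightarrow> 'a set \<Rightarrow> bool" where
  "gen_submodel sig E U D \<longleftrightarrow>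
     generalized_model sig E \<and> universe E = D \<and>
     lim_exists sig E \<and> lim_exists sig U \<and>
     submodel sig (lim_model sig E) (lim_model sig U)"


(* In the next three definitions the value x i is irrelevant: the section in the i-th coordinate
   is z \<mapsto> x(i := z).  Its first i entries lie in A, the later ones are arbitrary.
   (For empty Z there is no such x, but then every condition on sections is trivial.) *)
definition right_continuous_maps ::
  "'a topology \<Rightarrow> 'a set \<Rightarrow> nat \<Rightarrow> ((nat \<Rightarrow> 'a) \<Rightarrow> 'a) set" where
  "right_continuous_maps Z A n =
     {g \<in> operations n (topspace Z).
        \<forall>i<n. \<forall>x\<in>tuples n (topspace Z). (\<forall>j<i. x j \<in> A) \<longrightarrow>
          continuous_map Z Z (\<lambda>z. g (x(i := z)))}"

definition right_open :: "'a topology \<Rightarrow> 'a set \<Rightarrow> nat \<Rightarrow> (nat \<Rightarrow> 'a) set \<Rightarrow> bool" where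
  "right_open Z A n Q \<longleftrightarrow>
     Q \<subseteq> tuples n (topspace Z) \<and>
     (\<forall>i<n. \<forall>x\<in>tuples n (topspace Z). (\<forall>j<i. x j \<in> A) \<longrightarrow>
        openin Z {z \<in> topspace Z. x(i := z) \<in> Q})"

definition right_closed :: "'a topology \<Rightarrow> 'a set \<Rightarrow> nat \<Rightarrow> (nat \<Rightarrow> 'a) set \<Rightarrow> bool" where
  "right_closed Z A n Q \<longleftrightarrow>
     Q \<subseteq> tuples n (topspace Z) \<and>
     (\<forall>i<n. \<forall>x\<in>tuples n (topspace Z). (\<forall>j<i. x j \<in> A) \<longrightarrow>
        closedin Z {z \<in> topspace Z. x(i := z) \<in> Q})"

definition regular_closed :: "'a topology \<Rightarrow> 'a set \<Rightarrow> bool" where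
  "regular_closed T R \<longleftrightarrow> (\<exists>S. openin T S \<and> R = T closure_of S)"

end

theory Submission
  imports Defs
begin

text \<open>
  An identity or an implication known on \<open>D\<^sup>n\<close> is extended to \<open>X\<^sup>n\<close> one coordinate at a time, from
  the last coordinate to the first: while the coordinate \<open>k\<close> is being freed, the earlier ones still
  lie in \<open>D\<close>, so right continuity, openness or closedness with respect to \<open>D\<close> (and \<open>h ` D\<close>) applies
  to the section in the coordinate \<open>k\<close>, in which \<open>D\<close> is dense.  In the regular closed case \<open>D\<^sup>n\<close>
  meets the relation in a dense subset, and the preimage of a closed relation is closed.
\<close>

lemma tuples_mono: "A \<subseteq> B \<Longrightarrow> tuples n A \<subseteq> tuples n B"
  by (auto simp: tuples_def)

lemma tuples_upd: "x \<in> tuples n A \<Longrightarrow> k < n \<Longrightarrow> z \<in> A \<Longrightarrow> x(k := z) \<in> tuples n A"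
  by (auto simp: tuples_def PiE_iff extensional_def)

lemma tuples_nth: "x \<in> tuples n A \<Longrightarrow> k < n \<Longrightarrow> x k \<in> A"
  by (auto simp: tuples_def)

lemma topspace_power_top [simp]: "topspace (power_top T n) = tuples n (topspace T)"
  by (simp add: power_top_def tuples_def)

lemma tmap_nth [simp]: "k < n \<Longrightarrow> tmap n h x k = h (x k)"
  by (simp add: tmap_def)

text \<open>A section in coordinate \<open>k\<close> over \<open>x\<close> is hereby carried along
  \<open>h\<close> to the section over \<open>tmap n h x\<close>. The bound \<open>k < n\<close>
  matters, since \<open>tmap\<close> is \<open>undefined\<close> from \<open>n\<close> on.\<close>

lemma tmap_upd: "k < n \<Longrightarrow> tmap n h (x(k := z)) = (tmap n h x)(k := h z)"
  by (auto simp: tmap_def fun_eq_iff)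

lemma tmap_in_tuples: "h \<in> A \<rightarrow> B \<Longrightarrow> x \<in> tuples n A \<Longrightarrow> tmap n h x \<in> tuples n B"
  by (auto simp: tmap_def tuples_def PiE_iff)

lemma tmap_restrict: "x \<in> tuples n A \<Longrightarrow> tmap n (restrict h A) x = tmap n h x"
  by (auto simp: tmap_def tuples_def fun_eq_iff PiE_iff)

text \<open>By descending induction on \<open>k\<close>, \<open>P\<close> holds for the tuples whose
  first \<open>k\<close> entries lie in \<open>A\<close>: \<open>k = n\<close> is the base case,
  \<open>k = 0\<close> the conclusion, and for \<open>n = 0\<close> the two coincide. The rule
  leaves only one section at a time to topology.\<close>

lemma tuples_free_induct [consumes 2, case_names base step]:
  assumes "A \<subseteq> B" and "x \<in> tuples n B"
    and base: "\<And>x. x \<in> tuples n A \<Longrightarrow> P x"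
    and step: "\<And>k x. k < n \<Longrightarrow> x \<in> tuples n B \<Longrightarrow> \<forall>j<k. x j \<in> A \<Longrightarrow>
      (\<And>d. d \<in> A \<Longrightarrow> P (x(k := d))) \<Longrightarrow> P x"
  shows "P x"
proof -
  have "\<forall>x\<in>tuples n B. (\<forall>j<k. x j \<in> A) \<longrightarrow> P x" if "k \<le> n" for k
    using that
  proof (induction rule: inc_induct)
    case base
    then show ?case
      using assms(3) by (auto simp: tuples_def PiE_iff)
  next
    case (step k)
    show ?case
    proof (intro ballI impI)
      fix x assume x: "x \<in> tuples n B" "\<forall>j<k. x j \<in> A"
      show "P x"
      proof (rule assms(4)[OF \<open>k < n\<close> x])
        fix d assume "d \<in> A"
        then have "x(k := d) \<in> tuples n B" "\<forall>j<Suc k. (x(k := d)) j \<in> A"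
          using x step.hyps \<open>A \<subseteq> B\<close> by (auto simp: less_Suc_eq intro: tuples_upd)
        then show "P (x(k := d))"
          using step.IH by blast
      qed
    qed
  qed
  from this[of 0] show ?thesis
    using \<open>x \<in> tuples n B\<close> by simp
qed

text \<open>Along each section both sides are continuous functions of one variable into a Hausdorff
  space, and such functions agree if they agree on a dense set.\<close>

lemma right_continuous_hom_extend:
  assumes D: "D \<subseteq> topspace TX" "TX closure_of D = topspace TX"
    and TY: "Hausdorff_space TY" and h: "continuous_map TX TY h"
    and F: "F \<in> right_continuous_maps TX D n"
    and G: "G \<in> right_continuous_maps TY (h ` D) n"
    and hom: "\<And>x. x \<in> tuples n D \<Longrightarrow> h (F x) = G (tmap n h x)"
    and x: "x \<in> tuples n (topspace TX)"
  shows "h (F x) = G (tmap n h x)"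
  using D(1) x
proof (induction rule: tuples_free_induct)
  case (base x)
  then show ?case by (rule hom)
next
  case (step k x)
  have "tmap n h x \<in> tuples n (topspace TY)"
    using h step.hyps(2) by (auto intro: tmap_in_tuples dest: continuous_map_funspace)
  moreover have "\<forall>j<k. tmap n h x j \<in> h ` D"
    using step.hyps by simp
  ultimately have "continuous_map TY TY (\<lambda>y. G ((tmap n h x)(k := y)))"
    using G step.hyps(1) by (auto simp: right_continuous_maps_def)
  from continuous_map_compose[OF h this]
  have G': "continuous_map TX TY (\<lambda>z. G (tmap n h (x(k := z))))"
    using step.hyps(1) by (simp add: tmap_upd o_def)
  have "continuous_map TX TX (\<lambda>z. F (x(k := z)))"
    using F step.hyps by (auto simp: right_continuous_maps_def)
  from continuous_map_compose[OF this h]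
  have F': "continuous_map TX TY (\<lambda>z. h (F (x(k := z))))"
    by (simp add: o_def)
  \<comment> \<open>The section is evaluated at \<open>z = x k\<close>, where
    \<open>x(k := z)\<close> is \<open>x\<close> itself.\<close>
  have "x k \<in> TX closure_of D"
    using step.hyps D by (simp add: tuples_nth)
  from forall_in_closure_of_eq[OF this TY F' G' step.IH] show ?case
    by simp
qed

text \<open>An open section of \<open>R\<close> lies in the closure of its trace on
  \<open>D\<close>, and the preimage of a closed section of \<open>S\<close> contains that closure
  once it contains the trace. The conclusion is an implication so that each induction hypothesis
  carries its own premise about \<open>R\<close>.\<close>

lemma right_open_closed_hom_extend:
  assumes D: "D \<subseteq> topspace TX" "TX closure_of D = topspace TX"
    and h: "continuous_map TX TY h"
    and R: "right_open TX D n R" and S: "right_closed TY (h ` D) n S"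
    and hom: "\<And>x. x \<in> tuples n D \<Longrightarrow> x \<in> R \<Longrightarrow> tmap n h x \<in> S"
    and x: "x \<in> tuples n (topspace TX)"
  shows "x \<in> R \<longrightarrow> tmap n h x \<in> S"
  using D(1) x
proof (induction rule: tuples_free_induct)
  case (base x)
  then show ?case using hom by blast
next
  case (step k x)
  let ?O = "{z \<in> topspace TX. x(k := z) \<in> R}"
  let ?C = "{z \<in> topspace TX. h z \<in> {y \<in> topspace TY. (tmap n h x)(k := y) \<in> S}}"
  have xk: "x k \<in> topspace TX"
    using step.hyps by (simp add: tuples_nth)
  show ?case
  proof
    assume "x \<in> R"
    have "tmap n h x \<in> tuples n (topspace TY)"
      using h step.hyps(2) by (auto intro: tmap_in_tuples dest: continuous_map_funspace)
    moreover have "\<forall>j<k. tmap n h x j \<in> h ` D"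
      using step.hyps by simp
    ultimately have "closedin TY {y \<in> topspace TY. (tmap n h x)(k := y) \<in> S}"
      using S step.hyps(1) by (auto simp: right_closed_def)
    then have C: "closedin TX ?C"
      by (rule closedin_continuous_map_preimage[OF h])
    have O: "openin TX ?O"
      using R step.hyps by (auto simp: right_open_def)
    have "h z \<in> topspace TY \<and> (tmap n h x)(k := h z) \<in> S" if "z \<in> ?O \<inter> D" for z
      using step.IH[of z] step.hyps(1) that continuous_map_funspace[OF h]
      by (auto simp flip: tmap_upd simp del: fun_upd_apply)
    then have "?O \<inter> D \<subseteq> ?C"
      by blast
    then have "TX closure_of (?O \<inter> D) \<subseteq> ?C"
      using C by (rule closure_of_minimal)
    \<comment> \<open>Since \<open>x(k := x k)\<close> is \<open>x\<close>, the assumption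
      \<open>x \<in> R\<close> puts \<open>x k\<close> into \<open>?O\<close>.\<close>
    moreover have "x k \<in> TX closure_of (?O \<inter> D)"
      using openin_Int_closure_of_subset[OF O, of D] D(2) xk \<open>x \<in> R\<close> by auto
    ultimately have "(tmap n h x)(k := h (x k)) \<in> S"
      by blast
    then show "tmap n h x \<in> S"
      using step.hyps(1) tmap_upd[of k n h x "x k"] by simp
  qed
qed

lemma continuous_map_tmap:
  assumes "continuous_map TX TY h"
  shows "continuous_map (power_top TX n) (power_top TY n) (tmap n h)"
proof -
  have "continuous_map (power_top TX n) TY (\<lambda>x. h (x k))" if "k < n" for k
    using continuous_map_compose[OF continuous_map_product_projection[of k "{..<n}" "\<lambda>_. TX"] assms]
      that by (simp add: power_top_def o_def)
  \<comment> \<open>Only the topology of the codomain is unfolded, so that continuity is checked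
    componentwise.\<close>
  then show ?thesis
    by (subst (2) power_top_def) (auto simp: continuous_map_componentwise tmap_def)
qed

text \<open>All coordinates are treated at once: closure commutes with products, so the tuples from
  \<open>D\<close> are dense in the power, hence in the open set whose closure is \<open>R\<close>.
  The preimage of \<open>S\<close> is closed and therefore inherits first that open set, then
  \<open>R\<close>.\<close>

lemma regular_closed_hom_extend:
  assumes D: "TX closure_of D = topspace TX"
    and h: "continuous_map TX TY h"
    and R: "regular_closed (power_top TX n) R" and S: "closedin (power_top TY n) S"
    and hom: "\<And>x. x \<in> tuples n D \<Longrightarrow> x \<in> R \<Longrightarrow> tmap n h x \<in> S"
    and x: "x \<in> R"
  shows "tmap n h x \<in> S"
proof -
  let ?T = "power_top TX n"
  let ?C = "{x \<in> topspace ?T. tmap n h x \<in> S}"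
  obtain Q where Q: "openin ?T Q" and R_eq: "R = ?T closure_of Q"
    using R unfolding regular_closed_def by blast
  have Q_sub: "Q \<subseteq> topspace ?T"
    by (rule openin_subset[OF Q])
  then have Q_R: "Q \<subseteq> R"
    unfolding R_eq by (rule closure_of_subset)
  have C: "closedin ?T ?C"
    by (rule closedin_continuous_map_preimage[OF continuous_map_tmap[OF h] S])
  have dense: "?T closure_of tuples n D = topspace ?T"
    using D by (simp add: power_top_def tuples_def closure_of_product_topology)
  have "Q \<subseteq> ?T closure_of (Q \<inter> tuples n D)"
    using openin_Int_closure_of_subset[OF Q, of "tuples n D"] Q_sub unfolding dense by blast
  also have "\<dots> \<subseteq> ?C"
    using C Q_sub Q_R hom by (intro closure_of_minimal) auto
  finally have "R \<subseteq> ?C"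
    using C unfolding R_eq by (rule closure_of_minimal)
  then show ?thesis using x by blast
qed

text \<open>No separation of \<open>T\<close> is involved: uniqueness is part of
  \<open>has_limit\<close>.\<close>

lemma the_limit_eq: "has_limit T F p \<Longrightarrow> the_limit T F = p"
  unfolding the_limit_def by (rule the_equality) (auto simp: has_limit_def)

lemma has_limit_inD:
  assumes "has_limit_in T F C"
  shows "the_limit T F \<in> C" and "\<exists>p. has_limit T F p"
  using assms by (auto simp: has_limit_in_def the_limit_eq)

text \<open>This rewrites homomorphy on the submodel through the operations and relations of
  \<open>M\<close>, so that it differs from homomorphy on \<open>M\<close> only in the range of
  \<open>x\<close>. As \<open>mdom N\<close> is closed under the operations,
  \<open>restrict h (mdom N)\<close> still agrees with \<open>h\<close> at their values.\<close>

lemma model_hom_restrict_submodel: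
  assumes N: "submodel sig N M" and h: "h \<in> mdom M \<rightarrow> mdom K"
  shows "model_hom sig N K (restrict h (mdom N)) \<longleftrightarrow>
    (\<forall>f\<in>fsyms sig. \<forall>x\<in>tuples (far sig f) (mdom N).
       h (fn M f x) = fn K f (tmap (far sig f) h x)) \<and>
    (\<forall>p\<in>psyms sig. \<forall>x\<in>tuples (par sig p) (mdom N).
       x \<in> rel M p \<longrightarrow> tmap (par sig p) h x \<in> rel K p)"
  using N h by (auto simp: submodel_def model_hom_def tmap_restrict)

theorem theorem46:
  fixes sig :: "('f, 'p) signature"
    and U E :: "('a, 'f, 'p) gen_model"
    and V :: "('b, 'f, 'p) gen_model"
    and TX :: "'a topology" and TY :: "'b topology"
    and D :: "'a set" and h :: "'a \<Rightarrow> 'b"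
  assumes "generalized_model sig U" and "generalized_model sig V"
    and "topspace TX = universe U" and "topspace TY = universe V"
    and "Hausdorff_space TY"
    and "D \<subseteq> topspace TX" and "TX closure_of D = topspace TX"
    and "gen_submodel sig E U D"
    and "continuous_map TX TY h"
    and "\<And>n.
      (\<forall>f\<in>fsyms sig. far sig f = n \<longrightarrow>
         has_limit_in (ftop U n) (fint U f) (right_continuous_maps TX D n) \<and>
         has_limit_in (ftop V n) (fint V f) (right_continuous_maps TY (h ` D) n))"
    and "\<And>n.
      (\<forall>p\<in>psyms sig. par sig p = n \<longrightarrow>
         has_limit_in (ptop U n) (pint U p) {R. right_open TX D n R} \<and>
         has_limit_in (ptop V n) (pint V p) {S. right_closed TY (h ` D) n S})
      \<or>
      ((\<forall>p\<in>psyms sig. par sig p = n \<longrightarrow>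
         has_limit_in (ptop U n) (pint U p) {R. regular_closed (power_top TX n) R} \<and>
         has_limit_in (ptop V n) (pint V p) {S. closedin (power_top TY n) S}) \<and>
       closed_map TX TY h)"
  shows "gen_hom sig E V (restrict h D) \<longleftrightarrow> gen_hom sig U V h"
proof -
  let ?M = "lim_model sig U" and ?N = "lim_model sig E" and ?K = "lim_model sig V"
  note D = assms(6,7) and h = assms(9) and fun_lims = assms(10) and rel_lims = assms(11)
  have N: "submodel sig ?N ?M" "lim_exists sig E" "mdom ?N = D"
    using assms(8) by (auto simp: gen_submodel_def lim_model_def)
  have doms: "mdom ?M = topspace TX" "mdom ?K = topspace TY"
    using assms(3,4) by (auto simp: lim_model_def)
  have h_map: "h \<in> mdom ?M \<rightarrow> mdom ?K"
    using continuous_map_funspace[OF h] by (simp add: doms)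
  have "\<exists>R. has_limit (ptop U (par sig p)) (pint U p) R"
    and "\<exists>S. has_limit (ptop V (par sig p)) (pint V p) S" if "p \<in> psyms sig" for p
    using rel_lims[of "par sig p"] that by (auto dest: has_limit_inD(2))
  moreover have "\<exists>g. has_limit (ftop U (far sig f)) (fint U f) g"
    and "\<exists>g. has_limit (ftop V (far sig f)) (fint V f) g" if "f \<in> fsyms sig" for f
    using fun_lims[of "far sig f"] that by (auto dest: has_limit_inD(2))
  ultimately have lims: "lim_exists sig U" "lim_exists sig V"
    unfolding lim_exists_def by blast+
  have F: "fn ?M f \<in> right_continuous_maps TX D (far sig f)"
    and G: "fn ?K f \<in> right_continuous_maps TY (h ` D) (far sig f)" if "f \<in> fsyms sig" for f
    using fun_lims[of "far sig f"] that by (auto simp: lim_model_def dest: has_limit_inD(1))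
  \<comment> \<open>The alternative chosen for an arity becomes one for each pair of limit
    relations, and it decides which extension lemma applies.\<close>
  have R: "right_open TX D (par sig p) (rel ?M p) \<and>
        right_closed TY (h ` D) (par sig p) (rel ?K p) \<or>
      regular_closed (power_top TX (par sig p)) (rel ?M p) \<and>
        closedin (power_top TY (par sig p)) (rel ?K p)" if "p \<in> psyms sig" for p
    using rel_lims[of "par sig p"] that by (auto simp: lim_model_def dest!: has_limit_inD(1))
  \<comment> \<open>All three limit models exist, so it remains to compare ordinary
    homomorphisms.\<close>
  have "model_hom sig ?N ?K (restrict h D) \<longleftrightarrow> model_hom sig ?M ?K h"
  proof
    assume "model_hom sig ?M ?K h"
    moreover have "tuples n D \<subseteq> tuples n (mdom ?M)" for n
      using D(1) doms(1) by (simp add: tuples_mono)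
    ultimately show "model_hom sig ?N ?K (restrict h D)"
      using model_hom_restrict_submodel[OF N(1) h_map] N(3) unfolding model_hom_def by blast
  next
    assume "model_hom sig ?N ?K (restrict h D)"
    then have homf: "h (fn ?M f x) = fn ?K f (tmap (far sig f) h x)"
      if "f \<in> fsyms sig" "x \<in> tuples (far sig f) D" for f x
      using model_hom_restrict_submodel[OF N(1) h_map] N(3) that by simp
    have homp: "tmap (par sig p) h x \<in> rel ?K p"
      if "p \<in> psyms sig" "x \<in> tuples (par sig p) D" "x \<in> rel ?M p" for p x
      using \<open>model_hom sig ?N ?K (restrict h D)\<close> model_hom_restrict_submodel[OF N(1) h_map] N(3) that
      by simp
    show "model_hom sig ?M ?K h"
      unfolding model_hom_def
    proof (intro conjI ballI impI)
      show "h \<in> mdom ?M \<rightarrow> mdom ?K" by (rule h_map)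
    next
      fix f x assume "f \<in> fsyms sig" "x \<in> tuples (far sig f) (mdom ?M)"
      then show "h (fn ?M f x) = fn ?K f (tmap (far sig f) h x)"
        using right_continuous_hom_extend[OF D assms(5) h F G homf] doms(1) by simp
    next
      fix p x assume p: "p \<in> psyms sig" and x: "x \<in> tuples (par sig p) (mdom ?M)" "x \<in> rel ?M p"
      from R[OF p] show "tmap (par sig p) h x \<in> rel ?K p"
      proof (elim disjE conjE)
        assume "right_open TX D (par sig p) (rel ?M p)"
          and "right_closed TY (h ` D) (par sig p) (rel ?K p)"
        from right_open_closed_hom_extend[OF D h this homp[OF p]] show ?thesis
          using x doms(1) by simp
      next
        assume "regular_closed (power_top TX (par sig p)) (rel ?M p)"
          and "closedin (power_top TY (par sig p)) (rel ?K p)"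
        from regular_closed_hom_extend[OF D(2) h this homp[OF p]] show ?thesis
          using x(2) by simp
      qed
    qed
  qed
  then show ?thesis
    using N(2) lims by (simp add: gen_hom_def)
qed

end
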